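(* Let $M\in\mathbb{R}^{n\times n}$ be symmetric with eigenvalues $\lambda_1\ge\lambda_2\ge\cdots\ge\lambda_n$ (counted with multiplicity), and let $1\le p\le q\le n$ with $(p,q)\neq(1,n)$. Let $\mathbf{x}\in\mathbb{R}^n$ with $\|\mathbf{x}\|=1$ and suppose $\mu=\mathbf{x}^tM\mathbf{x}\in[\lambda_q,\lambda_p]$. Define $$\delta_{p,q}(\mu)=\min_{\{k<p\}\cup\{k>q\}}|\lambda_k-\mu| ,\qquad \mathcal{X}_p^q=\mathcal{X}_p+\mathcal{X}_{p+1}+\cdots+\mathcal{X}_q ,$$ where $\mathcal{X}_k=\{\mathbf{y}\in\mathbb{R}^n: M\mathbf{y}=\lambda_k\mathbf{y}\}$, and assume $\delta_{p,q}(\mu)>0$. Let $\epsilon=\|M\mathbf{x}-\mu\mathbf{x}\|$ and suppose $$\epsilon\le\min\left(\mu-\lambda_{q+1},\ \lambda_{p-1}-\mu\right),$$ where $\mu-\lambda_{q+1}$ is omitted from the minimum if $q=n$ and $\lambda_{p-1}-\mu$ is omitted if $p=1$. Then there exists a vector $\mathbf{v}\in\mathcal{X}_p^q$ with $\|\mathbf{v}\|=1$ and $$\|\mathbf{x}-\mathbf{v}\|\le\frac{\sqrt{2}\,\epsilon}{\delta_{p,q}(\mu)} .$$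
   Context: $\|\cdot\|$ is the Euclidean norm. The index $k$ in the minimum defining $\delta_{p,q}(\mu)$ ranges over $\{1,\dots,n\}$. *)

theory Defs
  imports "HOL-Analysis.Analysis" "HOL-Computational_Algebra.Polynomial"
begin

definition char_polynomial :: "real ^ 'n ^ 'n \<Rightarrow> real poly" where
  "char_polynomial M = det (mat [:0, 1:] - map_matrix (\<lambda>a. [:a:]) M)"

(* "lam 1 >= ... >= lam n are the eigenvalues of M, counted with (algebraic) multiplicity";
   values of lam outside {1..n} are irrelevant. *)
definition ordered_eigenvalues :: "real ^ 'n ^ 'n \<Rightarrow> (nat \<Rightarrow> real) \<Rightarrow> bool" where
  "ordered_eigenvalues M lam \<longleftrightarrow>
     char_polynomial M = (\<Prod>k = 1..CARD('n). [:- lam k, 1:]) \<and>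
     antimono_on {1..CARD('n)} lam"

definition eigenspace :: "real ^ 'n ^ 'n \<Rightarrow> real \<Rightarrow> (real ^ 'n) set" where
  "eigenspace M c = {y. M *v y = c *\<^sub>R y}"

(* The sum is the pointwise (Minkowski) sum of sets from HOL-Library.Set_Algebras,
   i.e. the sum of subspaces. *)
definition eigenspace_sum ::
    "real ^ 'n ^ 'n \<Rightarrow> (nat \<Rightarrow> real) \<Rightarrow> nat \<Rightarrow> nat \<Rightarrow> (real ^ 'n) set" where
  "eigenspace_sum M lam p q = (\<Sum>k = p..q. eigenspace M (lam k))"

(* The set is nonempty iff 1 < p or q < n (for p, q in {1..n}); otherwise the Min is unspecified. *)
definition spectral_distance :: "nat \<Rightarrow> (nat \<Rightarrow> real) \<Rightarrow> nat \<Rightarrow> nat \<Rightarrow> real \<Rightarrow> real" where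
  "spectral_distance n lam p q mu = Min {\<bar>lam k - mu\<bar> | k. k \<in> {1..n} \<and> (k < p \<or> k > q)}"

end

theory Submission
  imports Defs
begin

text \<open>
  Split \<open>x = y + z\<close> with \<open>y\<close> in \<open>W = \<X>\<^sub>p\<^sup>q\<close> and \<open>z\<close> orthogonal to \<open>W\<close>. Both \<open>W\<close> and its
  complement are invariant under \<open>M\<close>, so \<open>\<epsilon>\<^sup>2 \<ge> \<parallel>(M - \<mu>) z\<parallel>\<^sup>2\<close>. Every eigenvalue of \<open>M\<close> on the
  complement is some \<open>\<lambda>\<^sub>k\<close> with \<open>k\<close> outside \<open>{p..q}\<close>, so \<open>\<parallel>(M - \<mu>) z\<parallel> \<ge> \<delta> \<parallel>z\<parallel>\<close> and therefore
  \<open>\<parallel>z\<parallel> \<le> \<epsilon> / \<delta>\<close>. For \<open>v = y / \<parallel>y\<parallel>\<close> one gets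
  \<open>\<parallel>x - v\<parallel>\<^sup>2 = 2 - 2 \<surd>(1 - \<parallel>z\<parallel>\<^sup>2) \<le> 2 \<parallel>z\<parallel>\<^sup>2\<close>; if \<open>y = 0\<close>, any unit vector of \<open>W\<close> has distance
  \<open>\<surd>2 = \<surd>2 \<parallel>z\<parallel>\<close> from \<open>x\<close>.
\<close>

section \<open>Eigenvalues as roots of the characteristic polynomial\<close>

text \<open>Evaluation at \<open>c\<close> is a ring homomorphism, so it passes through the Leibniz
  expansion of the determinant.\<close>

lemma poly_char_polynomial:
  "poly (char_polynomial M) c = det (mat c - M :: real ^ 'n ^ 'n)"
  by (auto simp: char_polynomial_def det_def poly_sum poly_prod mat_def map_matrix_def
      intro!: sum.cong prod.cong)

lemma mat_mult_vec: "mat c *v x = c *\<^sub>R (x :: real ^ 'n)"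
proof -
  have "mat c = c *\<^sub>R (mat 1 :: real ^ 'n ^ 'n)"
    by (simp add: mat_def vec_eq_iff)
  then show ?thesis
    by (simp add: scaleR_matrix_vector_assoc[symmetric])
qed

lemma poly_char_polynomial_eq_0_iff:
  "poly (char_polynomial M) c = 0 \<longleftrightarrow> (\<exists>v. v \<noteq> 0 \<and> M *v v = c *\<^sub>R v)"
proof -
  have "det (mat c - M) = 0 \<longleftrightarrow> \<not> invertible (mat c - M)"
    by (simp add: invertible_det_nz)
  also have "\<dots> \<longleftrightarrow> (\<exists>v. v \<noteq> 0 \<and> (mat c - M) *v v = 0)"
    by (auto simp: invertible_left_inverse matrix_left_invertible_ker)
  finally show ?thesis
    by (auto simp: poly_char_polynomial matrix_vector_mult_diff_rdistrib mat_mult_vec)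
qed

text \<open>Bridge from the factored polynomial to eigenvectors: it yields an index for a given
  eigenvalue and an eigenvector for a given \<open>lam k\<close>.\<close>

lemma eigenvalue_iff:
  fixes M :: "real ^ 'n ^ 'n"
  assumes "ordered_eigenvalues M lam"
  shows "(\<exists>v. v \<noteq> 0 \<and> M *v v = c *\<^sub>R v) \<longleftrightarrow> c \<in> lam ` {1..CARD('n)}"
proof -
  have "poly (char_polynomial M) c = (\<Prod>k = 1..CARD('n). c - lam k)"
    using assms by (simp add: ordered_eigenvalues_def poly_prod)
  then show ?thesis
    by (auto simp flip: poly_char_polynomial_eq_0_iff)
qed

section \<open>Sums of eigenspaces as invariant subspaces\<close>

lemma subspace_eigenspace: "subspace (eigenspace M c)"
  by (auto simp: subspace_def eigenspace_def matrix_vector_mult_0_right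
      matrix_vector_right_distrib matrix_vector_mult_scaleR algebra_simps)

lemma mem_eigenspace_sum_iff:
  "y \<in> eigenspace_sum M lam p q \<longleftrightarrow>
    (\<exists>s. y = (\<Sum>k = p..q. s k) \<and> (\<forall>k\<in>{p..q}. s k \<in> eigenspace M (lam k)))"
  by (auto simp: eigenspace_sum_def set_sum_alt)

lemma subspace_eigenspace_sum: "subspace (eigenspace_sum M lam p q)"
  unfolding subspace_def mem_eigenspace_sum_iff Ball_def
proof (intro conjI allI impI)
  show "\<exists>s. 0 = (\<Sum>k = p..q. s k) \<and> (\<forall>k. k \<in> {p..q} \<longrightarrow> s k \<in> eigenspace M (lam k))"
    by (rule exI[of _ "\<lambda>_. 0"]) (simp add: subspace_0 subspace_eigenspace)
next
  fix y z
  assume "\<exists>s. y = (\<Sum>k = p..q. s k) \<and> (\<forall>k. k \<in> {p..q} \<longrightarrow> s k \<in> eigenspace M (lam k))"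
  then obtain s where "y = (\<Sum>k = p..q. s k)" "\<forall>k. k \<in> {p..q} \<longrightarrow> s k \<in> eigenspace M (lam k)"
    by blast
  moreover assume "\<exists>s. z = (\<Sum>k = p..q. s k) \<and> (\<forall>k. k \<in> {p..q} \<longrightarrow> s k \<in> eigenspace M (lam k))"
  then obtain t where "z = (\<Sum>k = p..q. t k)" "\<forall>k. k \<in> {p..q} \<longrightarrow> t k \<in> eigenspace M (lam k)"
    by blast
  ultimately show "\<exists>s. y + z = (\<Sum>k = p..q. s k) \<and> (\<forall>k. k \<in> {p..q} \<longrightarrow> s k \<in> eigenspace M (lam k))"
    by (intro exI[of _ "\<lambda>k. s k + t k"]) (simp add: sum.distrib subspace_add subspace_eigenspace)
next
  fix y c
  assume "\<exists>s. y = (\<Sum>k = p..q. s k) \<and> (\<forall>k. k \<in> {p..q} \<longrightarrow> s k \<in> eigenspace M (lam k))"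
  then obtain s where "y = (\<Sum>k = p..q. s k)" "\<forall>k. k \<in> {p..q} \<longrightarrow> s k \<in> eigenspace M (lam k)"
    by blast
  then show "\<exists>s. c *\<^sub>R y = (\<Sum>k = p..q. s k) \<and> (\<forall>k. k \<in> {p..q} \<longrightarrow> s k \<in> eigenspace M (lam k))"
    by (intro exI[of _ "\<lambda>k. c *\<^sub>R s k"]) (simp add: scaleR_sum_right subspace_scale subspace_eigenspace)
qed

lemma eigenspace_subset_eigenspace_sum:
  assumes "k \<in> {p..q}"
  shows "eigenspace M (lam k) \<subseteq> eigenspace_sum M lam p q"
proof
  fix y assume "y \<in> eigenspace M (lam k)"
  then show "y \<in> eigenspace_sum M lam p q"
    using assms unfolding mem_eigenspace_sum_iff
    by (intro exI[of _ "\<lambda>i. if i = k then y else 0"]) (auto simp: subspace_0 subspace_eigenspace)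
qed

lemma eigenspace_sum_invariant:
  assumes "y \<in> eigenspace_sum M lam p q"
  shows "M *v y \<in> eigenspace_sum M lam p q"
proof -
  obtain s where s: "y = (\<Sum>k = p..q. s k)" "\<forall>k\<in>{p..q}. s k \<in> eigenspace M (lam k)"
    using assms by (auto simp: mem_eigenspace_sum_iff)
  then have "M *v y = (\<Sum>k = p..q. lam k *\<^sub>R s k)"
    by (simp add: linear_sum[OF matrix_vector_mul_linear] eigenspace_def)
  moreover have "\<forall>k\<in>{p..q}. lam k *\<^sub>R s k \<in> eigenspace M (lam k)"
    using s(2) by (simp add: subspace_scale subspace_eigenspace)
  ultimately show ?thesis
    unfolding mem_eigenspace_sum_iff by (intro exI[of _ "\<lambda>k. lam k *\<^sub>R s k"]) simp
qed

section \<open>Lower bounds for self-adjoint maps by minimisation\<close>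

text \<open>First-order optimality: near \<open>t = 0\<close> the linear term dominates, so a
  nonzero \<open>b\<close> would make the expression negative on one side.\<close>

lemma quadratic_nonneg_imp_linear_coeff_0:
  fixes b c :: real
  assumes nonneg: "\<And>t. 0 \<le> 2 * t * b + t\<^sup>2 * c"
  shows "b = 0"
proof (rule ccontr)
  assume "b \<noteq> 0"
  \<comment> \<open>Any \<open>e > 0\<close> with \<open>e * c < 2\<close> makes the value at
    \<open>t = - e * b\<close> negative; the added 1 covers \<open>c = 0\<close>.\<close>
  define e where "e = 1 / (\<bar>c\<bar> + 1)"
  have e: "e > 0" "e * c < 2"
    by (auto simp: e_def field_simps)
  have "2 * (- e * b) * b + (- e * b)\<^sup>2 * c = e * b\<^sup>2 * (e * c - 2)"
    by (simp add: power2_eq_square algebra_simps)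
  also have "\<dots> < 0"
    using e \<open>b \<noteq> 0\<close> by (simp add: mult_less_0_iff)
  finally show False
    using nonneg[of "- e * b"] by simp
qed

text \<open>
  A minimiser \<open>u\<close> of \<open>\<parallel>f u\<parallel>\<close> on the unit sphere of \<open>V\<close>, with minimum \<open>m\<close>, satisfies
  \<open>f (f u) = m\<^sup>2 u\<close>; then \<open>f u + m u\<close>, or \<open>u\<close> itself if that vanishes, is an eigenvector
  for \<open>m\<close>, respectively \<open>- m\<close>.
\<close>
lemma selfadjoint_norm_lower_bound:
  fixes f :: "'a::euclidean_space \<Rightarrow> 'a"
  assumes lin: "linear f"
    and selfadj: "\<And>u w. f u \<bullet> w = u \<bullet> f w"
    and V: "subspace V"
    and inv: "\<And>u. u \<in> V \<Longrightarrow> f u \<in> V"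
    and eig: "\<And>u c. u \<in> V \<Longrightarrow> u \<noteq> 0 \<Longrightarrow> f u = c *\<^sub>R u \<Longrightarrow> d \<le> \<bar>c\<bar>"
    and z: "z \<in> V"
  shows "d * norm z \<le> norm (f z)"
proof (cases "z = 0")
  case True
  then show ?thesis by simp
next
  case False
  let ?S = "sphere 0 1 \<inter> V"
  have "compact ?S"
    by (intro compact_Int_closed compact_sphere closed_subspace V)
  moreover have normalize: "u /\<^sub>R norm u \<in> ?S" if "u \<in> V" "u \<noteq> 0" for u
    using that V by (simp add: subspace_scale)
  then have "?S \<noteq> {}"
    using z False by blast
  moreover have "continuous_on ?S (\<lambda>u. norm (f u))"
    by (intro continuous_on_norm linear_continuous_on linear_conv_bounded_linear[THEN iffD1] lin)
  ultimately obtain u where u: "u \<in> ?S" and u_min: "\<And>w. w \<in> ?S \<Longrightarrow> norm (f u) \<le> norm (f w)"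
    using continuous_attains_inf[of ?S "\<lambda>u. norm (f u)"] by blast
  define m where "m = norm (f u)"
  have lower: "m * norm w \<le> norm (f w)" if "w \<in> V" for w
  proof (cases "w = 0")
    case False
    then have "m \<le> norm (f (w /\<^sub>R norm w))"
      using u_min[OF normalize] that by (simp add: m_def)
    then show ?thesis
      using False by (simp add: linear_scale[OF lin] field_simps)
  qed simp
  have uV: "u \<in> V" and u1: "u \<bullet> u = 1"
    using u by (auto simp: dot_square_norm)
  \<comment> \<open>By \<open>lower\<close>, the squared norm of
    \<open>f (u + t *\<^sub>R w)\<close> minus \<open>m\<^sup>2\<close> times that of
    \<open>u + t *\<^sub>R w\<close> is nonnegative for all \<open>t\<close>. It vanishes at
    \<open>t = 0\<close>, and its linear coefficient is twice this inner product.\<close>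
  have orth: "(f (f u) - m\<^sup>2 *\<^sub>R u) \<bullet> w = 0" if w: "w \<in> V" for w
  proof (rule quadratic_nonneg_imp_linear_coeff_0)
    fix t :: real
    have "u + t *\<^sub>R w \<in> V"
      using uV w V by (simp add: subspace_add subspace_scale)
    then have "(m * norm (u + t *\<^sub>R w))\<^sup>2 \<le> (norm (f (u + t *\<^sub>R w)))\<^sup>2"
      by (intro power_mono lower) (simp_all add: m_def)
    then have "m\<^sup>2 * ((u + t *\<^sub>R w) \<bullet> (u + t *\<^sub>R w)) \<le> (f u + t *\<^sub>R f w) \<bullet> (f u + t *\<^sub>R f w)"
      by (simp add: power_mult_distrib power2_norm_eq_inner linear_add[OF lin] linear_scale[OF lin])
    moreover have "f u \<bullet> f u = m\<^sup>2"
      by (simp add: m_def power2_norm_eq_inner)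
    moreover have "f (f u) \<bullet> w = f u \<bullet> f w"
      by (rule selfadj)
    ultimately show "0 \<le> 2 * t * ((f (f u) - m\<^sup>2 *\<^sub>R u) \<bullet> w) + t\<^sup>2 * (f w \<bullet> f w - m\<^sup>2 * (w \<bullet> w))"
      using u1
      by (simp add: inner_add_left inner_add_right inner_diff_left inner_commute[of w u]
          inner_commute[of "f w" "f u"] algebra_simps power2_eq_square)
  qed
  \<comment> \<open>The residual lies in \<open>V\<close>, so \<open>orth\<close> makes it
    orthogonal to itself.\<close>
  have "f (f u) - m\<^sup>2 *\<^sub>R u \<in> V"
    using uV V inv by (simp add: subspace_diff subspace_scale)
  then have ffu: "f (f u) = m\<^sup>2 *\<^sub>R u"
    using orth[of "f (f u) - m\<^sup>2 *\<^sub>R u"] by simp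
  have "d \<le> m"
  proof (cases "f u + m *\<^sub>R u = 0")
    case True
    then have "f u = (- m) *\<^sub>R u"
      by (simp add: eq_neg_iff_add_eq_0)
    then show ?thesis
      using eig[of u "- m"] uV u1 by (force simp: m_def)
  next
    case False
    have "f u + m *\<^sub>R u \<in> V"
      using uV V inv by (simp add: subspace_add subspace_scale)
    moreover have "f (f u + m *\<^sub>R u) = m *\<^sub>R (f u + m *\<^sub>R u)"
      by (simp add: linear_add[OF lin] linear_scale[OF lin] ffu power2_eq_square algebra_simps)
    ultimately show ?thesis
      using eig False by (fastforce simp: m_def)
  qed
  then have "d * norm z \<le> m * norm z"
    by (simp add: mult_right_mono)
  also have "\<dots> \<le> norm (f z)"
    by (rule lower[OF z])
  finally show ?thesis .
qed

section \<open>Normalising the orthogonal projection\<close>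

lemma exists_unit_vector_near:
  fixes x y z :: "'a::euclidean_space"
  assumes W: "subspace W" "w \<in> W" "w \<noteq> 0"
    and x: "norm x = 1" "x = y + z"
    and y: "y \<in> W"
    and z: "\<And>u. u \<in> W \<Longrightarrow> z \<bullet> u = 0"
  shows "\<exists>v\<in>W. norm v = 1 \<and> norm (x - v) \<le> sqrt 2 * norm z"
proof -
  have pyth: "(norm y)\<^sup>2 + (norm z)\<^sup>2 = 1"
    using x z[OF y] norm_add_Pythagorean[of y z] by (simp add: orthogonal_def inner_commute)
  \<comment> \<open>If \<open>y = 0\<close>, the direction comes from \<open>w\<close>; the equation
    for \<open>y\<close> then holds in both cases and no further split is needed.\<close>
  obtain v where v: "v \<in> W" "norm v = 1" "y = norm y *\<^sub>R v"
  proof (cases "y = 0")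
    case True
    show ?thesis
      by (rule that[of "w /\<^sub>R norm w"]) (use True W in \<open>simp_all add: subspace_scale\<close>)
  next
    case False
    show ?thesis
      by (rule that[of "y /\<^sub>R norm y"]) (use False W y in \<open>simp_all add: subspace_scale\<close>)
  qed
  have "x \<bullet> v = norm y"
  proof -
    have "x \<bullet> v = norm y * (v \<bullet> v) + z \<bullet> v"
      unfolding x(2) by (subst v(3)) (simp add: inner_add_left)
    then show ?thesis
      using v z by (simp add: dot_square_norm)
  qed
  then have "(norm (x - v))\<^sup>2 = 2 - 2 * norm y"
    using x(1) v(2) by (simp add: dot_norm_neg field_simps)
  \<comment> \<open>With \<open>norm y \<le> 1\<close>, the value \<open>2 - 2 * norm y\<close> is
    at most \<open>2 - 2 * (norm y)\<^sup>2\<close>, which \<open>pyth\<close> turns into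
    \<open>2 * (norm z)\<^sup>2\<close>.\<close>
  moreover have "(norm y)\<^sup>2 \<le> 1"
    using pyth zero_le_power2[of "norm z"] by linarith
  then have "norm y \<le> 1"
    by (simp add: power_le_one_iff)
  then have "(norm y)\<^sup>2 \<le> norm y"
    using mult_left_mono[of "norm y" 1 "norm y"] by (simp add: power2_eq_square)
  ultimately have "(norm (x - v))\<^sup>2 \<le> (sqrt 2 * norm z)\<^sup>2"
    using pyth by (simp add: power_mult_distrib)
  then have "norm (x - v) \<le> sqrt 2 * norm z"
    by (rule power2_le_imp_le) simp
  then show ?thesis
    using v by blast
qed

theorem theorem3:
  fixes M :: "real ^ 'n ^ 'n" and x :: "real ^ 'n"
    and lam :: "nat \<Rightarrow> real" and p q :: nat and mu eps :: real
  assumes "transpose M = M"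
    and "ordered_eigenvalues M lam"
    and "1 \<le> p" and "p \<le> q" and "q \<le> CARD('n)"
    and "(p, q) \<noteq> (1, CARD('n))"
    and "norm x = 1"
    and "mu = x \<bullet> (M *v x)"
    and "mu \<in> {lam q..lam p}"
    and "spectral_distance CARD('n) lam p q mu > 0"
    and "eps = norm (M *v x - mu *\<^sub>R x)"
    and "q < CARD('n) \<Longrightarrow> eps \<le> mu - lam (q + 1)"
    and "1 < p \<Longrightarrow> eps \<le> lam (p - 1) - mu"
  shows "\<exists>v \<in> eigenspace_sum M lam p q. norm v = 1 \<and>
           norm (x - v) \<le> sqrt 2 * eps / spectral_distance CARD('n) lam p q mu"
proof -
  define W where "W = eigenspace_sum M lam p q"
  define V where "V = {z. \<forall>u\<in>W. z \<bullet> u = 0}"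
  define d where "d = spectral_distance CARD('n) lam p q mu"
  define f where "f = (\<lambda>u. M *v u - mu *\<^sub>R u)"
  have lin: "linear f"
    unfolding f_def
    by (intro linear_compose_sub matrix_vector_mul_linear linear_scaleR)
  have selfadj: "f u \<bullet> w = u \<bullet> f w" for u w
    using assms(1) dot_lmul_matrix[of u M w] transpose_matrix_vector[of M u]
    by (simp add: f_def inner_diff_left inner_diff_right)
  have W: "subspace W"
    unfolding W_def by (rule subspace_eigenspace_sum)
  have fW: "f u \<in> W" if "u \<in> W" for u
    using that W eigenspace_sum_invariant[of u M lam p q]
    by (simp add: f_def W_def subspace_diff subspace_scale)
  have V: "subspace V"
    by (auto simp: V_def subspace_def inner_add_left)
  \<comment> \<open>Self-adjointness moves \<open>f\<close> onto the vectors of \<open>W\<close>,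
    and \<open>f\<close> maps these into \<open>W\<close>.\<close>
  have fV: "f u \<in> V" if "u \<in> V" for u
    using that fW by (simp add: V_def selfadj)
  have eig: "d \<le> \<bar>c\<bar>" if u: "u \<in> V" "u \<noteq> 0" "f u = c *\<^sub>R u" for u c
  proof -
    have Mu: "M *v u = (c + mu) *\<^sub>R u"
      using u(3) by (simp add: f_def algebra_simps)
    then obtain k where k: "k \<in> {1..CARD('n)}" "c + mu = lam k"
      using eigenvalue_iff[OF assms(2), of "c + mu"] u(2) by auto
    \<comment> \<open>Otherwise \<open>u\<close> would lie in \<open>W\<close> and be orthogonal to
      it. This applies to whichever index \<open>k\<close> was obtained, so ties among the
      eigenvalues do no harm.\<close>
    have "k \<notin> {p..q}"
    proof
      assume "k \<in> {p..q}"
      then have "u \<in> W"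
        using eigenspace_subset_eigenspace_sum[of k p q M lam] Mu k(2)
        by (auto simp: W_def eigenspace_def)
      then have "u \<bullet> u = 0"
        using u(1) by (simp add: V_def)
      then show False
        using u(2) by simp
    qed
    then have "\<bar>lam k - mu\<bar> \<in> {\<bar>lam k - mu\<bar> | k. k \<in> {1..CARD('n)} \<and> (k < p \<or> k > q)}"
      using k(1) by auto
    then have "d \<le> \<bar>lam k - mu\<bar>"
      unfolding d_def spectral_distance_def by (intro Min_le) auto
    then show ?thesis
      by (simp flip: k(2))
  qed
  obtain y z where yz: "y \<in> W" "z \<in> V" "x = y + z"
    using orthogonal_subspace_decomp_exists[of W x] W
    unfolding V_def orthogonal_def mem_Collect_eq by (metis span_eq_iff)
  have "d * norm z \<le> norm (f z)"
    by (rule selfadjoint_norm_lower_bound[OF lin selfadj V fV eig yz(2)])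
  also have "\<dots> \<le> eps"
  proof -
    have "f z \<bullet> f y = 0"
      using fV[OF yz(2)] fW[OF yz(1)] by (simp add: V_def)
    then have "(norm (f x))\<^sup>2 = (norm (f y))\<^sup>2 + (norm (f z))\<^sup>2"
      using norm_add_Pythagorean[of "f y" "f z"]
      by (simp add: yz(3) linear_add[OF lin] orthogonal_def inner_commute)
    then have "(norm (f z))\<^sup>2 \<le> (norm (f x))\<^sup>2"
      by simp
    then show ?thesis
      unfolding assms(11) f_def by (rule power2_le_imp_le) simp
  qed
  finally have "norm z \<le> eps / d"
    using assms(10) by (simp add: d_def field_simps)
  then have bound: "sqrt 2 * norm z \<le> sqrt 2 * eps / d"
    using mult_left_mono[of "norm z" "eps / d" "sqrt 2"] by simp
  \<comment> \<open>An eigenvector for \<open>lam p\<close> shows that \<open>W\<close> is nonzero,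
    as required when the projection \<open>y\<close> vanishes.\<close>
  obtain w where w: "w \<noteq> 0" "M *v w = lam p *\<^sub>R w"
    using eigenvalue_iff[OF assms(2), of "lam p"] assms(3-5) by auto
  then have "w \<in> W"
    using eigenspace_subset_eigenspace_sum[of p p q M lam] assms(4)
    by (auto simp: W_def eigenspace_def)
  then obtain v where "v \<in> W" "norm v = 1" "norm (x - v) \<le> sqrt 2 * norm z"
    using exists_unit_vector_near[OF W _ w(1) assms(7) yz(3,1)] yz(2) by (auto simp: V_def)
  then show ?thesis
    using bound unfolding W_def d_def by (intro bexI[of _ v]) auto
qed

end
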